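(* Let $F(X)\in\mathbb Z[X]$ be a non-constant monic polynomial and $t\in\mathbb Z$. The Diophantine equation $$F\left(\frac{x_1^2+x_2^4+x_3^4+2x_1x_2^2+2x_1x_3^2}{x_1x_2^2x_3^2}\right)=F(t)$$ has a solution $(x_1,x_2,x_3)$ in positive integers if and only if $F(t)=F(7)$. In this case, all the positive integer solutions can be obtained from the initial solution $(1,1,1)$ by finitely many cluster mutations of $\mathcal A_L$.
   Context: $\mathcal A_L$ is the cluster algebra with initial exchange matrix $\begin{pmatrix}0&1&-1\\-4&0&2\\4&-2&0\end{pmatrix}$. Its cluster mutations act on triples by $\mu_1(x_1,x_2,x_3)=\left(\frac{x_2^4+x_3^4}{x_1},x_2,x_3\right)$, $\mu_2(x_1,x_2,x_3)=\left(x_1,\frac{x_1+x_3^2}{x_2},x_3\right)$, $\mu_3(x_1,x_2,x_3)=\left(x_1,x_2,\frac{x_1+x_2^2}{x_3}\right)$. A triple is obtained from $(1,1,1)$ by finitely many cluster mutations of $\mathcal A_L$ if it equals the result of applying a finite (possibly empty) sequence of the maps $\mu_1,\mu_2,\mu_3$ to $(1,1,1)$. *)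

theory Defs
  imports Complex_Main "HOL-Computational_Algebra.Polynomial"
begin

definition laurent_expr :: "int \<Rightarrow> int \<Rightarrow> int \<Rightarrow> rat" where
  "laurent_expr x1 x2 x3 =
     of_int (x1^2 + x2^4 + x3^4 + 2 * x1 * x2^2 + 2 * x1 * x3^2) / of_int (x1 * x2^2 * x3^2)"

text \<open>
  \<open>F\<close> has integer coefficients but is evaluated at a rational number, hence the coefficientwise
  embedding \<open>map_poly of_int\<close>.
\<close>

definition pos_int_solution :: "int poly \<Rightarrow> int \<Rightarrow> int \<Rightarrow> int \<Rightarrow> int \<Rightarrow> bool" where
  "pos_int_solution F t x1 x2 x3 \<longleftrightarrow>
     x1 > 0 \<and> x2 > 0 \<and> x3 > 0 \<and>
     poly (map_poly of_int F) (laurent_expr x1 x2 x3) = of_int (poly F t)"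

text \<open>
  Cluster mutations of the cluster algebra with initial exchange matrix
  \<open>B = ((0, 1, -1), (-4, 0, 2), (4, -2, 0))\<close>: the exponents in the \<open>k\<close>-th exchange relation are
  the positive and the negative parts of the \<open>k\<close>-th column of \<open>B\<close>. Every matrix mutation sends
  \<open>B\<close> to \<open>-B\<close>, so the same three formulas hold at every seed. They act on rational triples,
  since integer division would truncate.
\<close>

definition mu1 :: "rat \<times> rat \<times> rat \<Rightarrow> rat \<times> rat \<times> rat" where
  "mu1 = (\<lambda>(x1, x2, x3). ((x2^4 + x3^4) / x1, x2, x3))"

definition mu2 :: "rat \<times> rat \<times> rat \<Rightarrow> rat \<times> rat \<times> rat" where
  "mu2 = (\<lambda>(x1, x2, x3). (x1, (x1 + x3^2) / x2, x3))"

definition mu3 :: "rat \<times> rat \<times> rat \<Rightarrow> rat \<times> rat \<times> rat" where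
  "mu3 = (\<lambda>(x1, x2, x3). (x1, x2, (x1 + x2^2) / x3))"

inductive_set mutation_orbit :: "(rat \<times> rat \<times> rat) set" where
  initial: "(1, 1, 1) \<in> mutation_orbit"
| mu1: "x \<in> mutation_orbit \<Longrightarrow> mu1 x \<in> mutation_orbit"
| mu2: "x \<in> mutation_orbit \<Longrightarrow> mu2 x \<in> mutation_orbit"
| mu3: "x \<in> mutation_orbit \<Longrightarrow> mu3 x \<in> mutation_orbit"

end

theory Submission
  imports Defs
begin

text \<open>
  The Laurent expression is invariant under the three mutations, and it is quadratic in each of
  \<open>x\<^sub>1\<close>, \<open>x\<^sub>2\<^sup>2\<close>, \<open>x\<^sub>3\<^sup>2\<close> after clearing
  denominators: a mutation exchanges the two roots of the corresponding quadratic. A value of the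
  expression that solves the equation is a rational root of the monic integer polynomial
  \<open>F - F(t)\<close>, hence an integer \<open>k\<close>, and then Vieta's formulas show that mutations
  carry positive integer solutions with value \<open>k\<close> to positive integer solutions with the
  same value.

  This gives a descent: as long as some mutation decreases a coordinate, apply it. The descent ends
  at a triple none of whose coordinates can be decreased, so that each coordinate is the smaller
  root of its quadratic. The resulting inequalities are
  \<open>x\<^sub>1\<^sup>2 \<le> x\<^sub>2\<^sup>4 + x\<^sub>3\<^sup>4\<close> and
  \<open>\<bar>x\<^sub>2\<^sup>2 - x\<^sub>3\<^sup>2\<bar> \<le> x\<^sub>1\<close>. For
  \<open>x\<^sub>2 \<noteq> x\<^sub>3\<close> they make the expression too small to be a positive integer unless
  \<open>min x\<^sub>2 x\<^sub>3\<close> is small; for \<open>x\<^sub>2 = x\<^sub>3\<close> divisibility bounds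
  \<open>x\<^sub>2\<close>. The remaining cases leave only \<open>(1, 1, 1)\<close>, where the value is
  \<open>7\<close> (\<open>irreducible_solution\<close>). Since mutations are involutions, the descent run
  backwards produces the solution from \<open>(1, 1, 1)\<close> (\<open>level_eq_descent\<close>).
\<close>

section \<open>The equation over the integers and its mutations\<close>

text \<open>
  The equation \<open>laurent_expr a b c = k\<close> cleared of denominators, so that the descent takes place
  in the integers.
\<close>
definition level_eq :: "int \<Rightarrow> int \<Rightarrow> int \<Rightarrow> int \<Rightarrow> bool" where
  "level_eq k a b c \<longleftrightarrow>
     a^2 + b^4 + c^4 + 2 * a * b^2 + 2 * a * c^2 = k * a * b^2 * c^2"

lemma level_eq_swap: "level_eq k a b c \<longleftrightarrow> level_eq k a c b"
  by (auto simp: level_eq_def algebra_simps)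

lemma level_eq_pos:
  assumes "level_eq k a b c" "a > 0" "b > 0" "c > 0"
  shows "k > 0"
proof -
  have "k * (a * b^2 * c^2) > 0"
    using assms unfolding level_eq_def
    by (metis (no_types, lifting) add_pos_pos mult.assoc mult_pos_pos zero_less_numeral zero_less_power)
  moreover have "a * b^2 * c^2 > 0" using assms by simp
  ultimately show ?thesis by (rule zero_less_mult_pos2)
qed

lemma level_eq_mutate_first:
  assumes "level_eq k a b c" "a > 0" "b > 0" "c > 0"
  obtains a' where "a' > 0" "a * a' = b^4 + c^4" "level_eq k a' b c"
proof -
  define a' where "a' = k * b^2 * c^2 - 2 * b^2 - 2 * c^2 - a"
  have prod: "a * a' = b^4 + c^4"
    using assms(1) unfolding level_eq_def a'_def by algebra
  have "b^4 + c^4 > 0" using assms by (simp add: add_pos_pos)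
  with prod \<open>a > 0\<close> have "a' > 0" by (metis zero_less_mult_pos)
  moreover have "level_eq k a' b c"
    using prod unfolding level_eq_def a'_def by algebra
  ultimately show ?thesis using prod that by blast
qed

text \<open>
  The equation is a monic integer quadratic in \<open>b\<^sup>2\<close> whose roots have the product
  \<open>(a + c\<^sup>2)\<^sup>2\<close>. One root and the product are squares, so the other root, an integer,
  is a square too.
\<close>
lemma level_eq_mutate_second:
  assumes "level_eq k a b c" "a > 0" "b > 0" "c > 0"
  obtains b' where "b' > 0" "b * b' = a + c^2" "level_eq k a b' c"
proof -
  define q where "q = k * a * c^2 - 2 * a - b^2"
  have q: "b^2 * q = (a + c^2)^2"
    using assms(1) unfolding level_eq_def q_def by algebra
  then have "b^2 dvd (a + c^2)^2" by (metis dvd_triv_left)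
  then have "b dvd a + c^2" by simp
  then obtain b' where b': "a + c^2 = b * b'" by (elim dvdE)
  have "a + c^2 > 0" using assms by (simp add: add_pos_pos)
  with b' \<open>b > 0\<close> have pos: "b' > 0" by (metis zero_less_mult_pos)
  have "b^2 * q = b^2 * b'^2" using q b' by (simp add: power_mult_distrib)
  then have q': "q = b'^2" using \<open>b > 0\<close> by simp
  have "a^2 + q^2 + c^4 + 2 * a * q + 2 * a * c^2 = k * a * q * c^2"
    using q unfolding q_def by algebra
  then have "level_eq k a b' c"
    unfolding level_eq_def q' by (simp add: power_mult[symmetric])
  then show ?thesis using pos b' that by metis
qed

section \<open>Solutions that no mutation decreases\<close>

text \<open>
  The hypotheses leave only \<open>a = b\<^sup>2\<close> and \<open>a = b\<^sup>2 - 1\<close>, and in each case the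
  equation factors. In the second case it has solutions with \<open>2\<close> or \<open>3\<close> in place of
  \<open>b\<^sup>2\<close> (and \<open>k = 6\<close> or \<open>k = 5\<close>), so it is essential that
  \<open>b\<^sup>2\<close> is a square.
\<close>
lemma irreducible_min_one:
  fixes k a b :: int
  assumes eq: "level_eq k a b 1" and pos: "a > 0" "b > 0"
    and h1: "a^2 \<le> b^4 + 1" and h2: "b^2 \<le> a + 1"
  shows "k = 7 \<and> a = 1 \<and> b = 1"
proof -
  define B where "B = b^2"
  have B4: "b^4 = B^2" by (simp add: B_def power_mult[symmetric])
  have "B > 0" using pos by (simp add: B_def)
  have E: "(a - B)^2 + 2 * a + 1 = (k - 4) * a * B"
    using eq unfolding level_eq_def B4 B_def[symmetric]
    by (simp add: power2_eq_square algebra_simps)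
  have "a \<le> B"
  proof (rule ccontr)
    assume "\<not> a \<le> B"
    then have "(B + 1)^2 \<le> a^2" using \<open>B > 0\<close> by (intro power_mono) auto
    then show False using h1 \<open>B > 0\<close> unfolding B4 by (simp add: power2_eq_square algebra_simps)
  qed
  then consider "a = B" | "a = B - 1" using h2 unfolding B_def[symmetric] by linarith
  then show ?thesis
  proof cases
    case 1
    have "a * ((k - 4) * a - 2) = 1" using E 1 by algebra
    then have "a = 1" using pos by (simp add: zmult_eq_1_iff)
    moreover have "b = 1" using 1 \<open>a = 1\<close> pos unfolding B_def by (simp add: power2_eq_1_iff)
    ultimately show ?thesis using E 1 by auto
  next
    case 2
    have "B * ((k - 4) * a) = B * 2" using E 2 by algebra
    then have "(k - 4) * a = 2" using \<open>B > 0\<close> by simp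
    then have "a dvd 2" by (metis dvd_triv_right)
    then have "a \<le> 2" by (rule zdvd_imp_le) simp
    then have "B = 2 \<or> B = 3" using 2 pos by linarith
    moreover have "b = 1 \<or> b \<ge> 2" using pos by linarith
    moreover have "b \<ge> 2 \<Longrightarrow> B \<ge> 2 * 2"
      unfolding B_def power2_eq_square by (intro mult_mono) auto
    ultimately show ?thesis by (auto simp: B_def)
  qed
qed

text \<open>
  If \<open>b = c\<close>, the equation forces \<open>b\<close> to divide \<open>a\<close>, and dividing it by
  \<open>b\<^sup>2\<close> leaves a relation that bounds \<open>b\<close>.
\<close>
lemma irreducible_diagonal:
  fixes k a b :: int
  assumes eq: "level_eq k a b b" and pos: "a > 0" and b: "b \<ge> 2" and h1: "a^2 \<le> 2 * b^4"
  shows False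
proof -
  have k: "k > 0" using level_eq_pos[OF eq] pos b by simp
  have "a^2 = b^2 * (k * a * b^2 - 2 * b^2 - 4 * a)"
    using eq unfolding level_eq_def by algebra
  then have "b^2 dvd a^2" by (metis dvd_triv_left)
  then have "b dvd a" by simp
  then obtain m where m: "a = b * m" by (elim dvdE)
  have "m > 0" using pos b m by (simp add: zero_less_mult_iff)
  have "b^2 * (m^2 + 2 * b^2 + 4 * b * m) = b^2 * (k * m * b^3)"
    using eq unfolding level_eq_def m by algebra
  then have M: "m^2 + 2 * b^2 + 4 * b * m = k * m * b^3" using b by simp
  have "2 * b^4 = b^2 * (2 * b^2)" by algebra
  then have "b^2 * m^2 \<le> b^2 * (2 * b^2)"
    using h1 unfolding m by (simp only: power_mult_distrib)
  then have m2: "m^2 \<le> 2 * b^2" using b by (simp add: mult_le_cancel_left)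
  have "1 * (m * b^3) \<le> k * (m * b^3)" using k \<open>m > 0\<close> b by (intro mult_right_mono) auto
  then have "b * (m * b^2) \<le> b * (4 * b + 4 * m)"
    using M m2 by (simp add: algebra_simps power2_eq_square power3_eq_cube)
  then have bound: "m * b^2 \<le> 4 * b + 4 * m" using b by simp
  have "m^2 = b * (k * m * b^2 - 2 * b - 4 * m)" using M by algebra
  then have bm: "b dvd m^2" by (metis dvd_triv_left)
  have "m \<noteq> 1" using bm b by auto
  then have "m \<ge> 2" using \<open>m > 0\<close> by linarith
  consider "b = 2" | "b = 3" | "b \<ge> 4" using b by linarith
  then show False
  proof cases
    case 1
    have "m^2 = 8 * (k * m - m - 1)" using M 1 by (simp add: algebra_simps)
    moreover have "m = 2"
    proof -
      have "\<not> m \<ge> 3"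
      proof
        assume "m \<ge> 3"
        then have "3^2 \<le> m^2" by (intro power_mono) auto
        then show False using m2 1 by simp
      qed
      then show ?thesis using \<open>m \<ge> 2\<close> by linarith
    qed
    ultimately have "4 = 8 * (2 * k - 3)" by simp
    then show False by presburger
  next
    case 2
    have "m = 2" using bound 2 \<open>m \<ge> 2\<close> by simp
    then show False using bm 2 by simp
  next
    case 3
    have "2 * (b^2 - 4) \<le> m * (b^2 - 4)"
    proof (rule mult_right_mono)
      have "4 * 4 \<le> b * b" using 3 by (intro mult_mono) auto
      then show "0 \<le> b^2 - 4" by (simp add: power2_eq_square)
    qed (use \<open>m \<ge> 2\<close> in simp)
    then have "2 * b^2 - 8 \<le> m * b^2 - 4 * m" by (simp add: algebra_simps)
    moreover have "4 * b \<le> b^2" unfolding power2_eq_square using 3 b by (intro mult_right_mono) auto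
    ultimately show False using bound 3 by linarith
  qed
qed

text \<open>
  Write \<open>B = b\<^sup>2\<close> and \<open>C = c\<^sup>2\<close>. Then
  \<open>k = a / (B C) + B / (a C) + C / (a B) + 2 / C + 2 / B\<close>, and the hypotheses bound each
  term by a multiple of \<open>1 / C\<close> plus a multiple of \<open>1 / a\<close>, where
  \<open>a \<ge> B - C \<ge> 2 c + 1\<close> because distinct squares are far apart. From \<open>c = 4\<close>
  on, the sum is below \<open>1\<close>; for \<open>c = 3\<close> the same estimate leaves one candidate. For
  \<open>c = 2\<close> the sum tends to exactly \<open>1\<close> as \<open>a = B\<close> grows, so no estimate of
  this kind can succeed: there \<open>k = 1\<close> is excluded by completing a square, and only
  \<open>k \<ge> 2\<close> is refuted by size.
\<close>
lemma irreducible_strict: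
  fixes k a b c :: int
  assumes eq: "level_eq k a b c" and pos: "a > 0" and c: "c \<ge> 2" and bc: "c < b"
    and h1: "a^2 \<le> b^4 + c^4" and h2: "b^2 \<le> a + c^2"
  shows False
proof -
  have k: "k > 0" using level_eq_pos[OF eq] pos c bc by simp
  define B where "B = b^2"
  define C where "C = c^2"
  have B4: "b^4 = B^2" and C4: "c^4 = C^2" by (simp_all add: B_def C_def power_mult[symmetric])
  have "(c + 1)^2 \<le> b^2" using bc c by (intro power_mono) auto
  then have BC: "B \<ge> C + 2 * c + 1" by (simp add: B_def C_def power2_eq_square algebra_simps)
  have C0: "C > 0" using c by (simp add: C_def)
  have E: "a^2 + B^2 + C^2 + 2 * a * B + 2 * a * C = k * (a * B * C)"
    using eq unfolding level_eq_def B4 C4 B_def[symmetric] C_def[symmetric] by (simp add: mult.assoc)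
  have H1: "a^2 \<le> B^2 + C^2" using h1 by (simp add: B4 C4)
  have H2: "B \<le> a + C" using h2 by (simp add: B_def C_def)
  have a: "a \<ge> 2 * c + 1" using H2 BC by linarith
  \<comment> \<open>The bound on the sum for \<open>k \<ge> 1\<close>, multiplied by \<open>a B C\<close>.\<close>
  have "1 * (a * B * C) \<le> k * (a * B * C)"
    using k pos BC C0 c by (intro mult_right_mono) auto
  then have "a * B * C \<le> a^2 + B^2 + C^2 + 2 * a * B + 2 * a * C" using E by simp
  moreover have "B * B \<le> B * (a + C)" using H2 BC C0 c by (intro mult_left_mono) auto
  ultimately have main: "a * (B * C - 4 * B - 2 * C) \<le> 2 * B * C + 2 * C^2"
    using H1 by (simp add: algebra_simps power2_eq_square)
  consider "c = 2" | "c = 3" | "c \<ge> 4" using c by linarith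
  then show False
  proof cases
    case 1
    then have C: "C = 4" by (simp add: C_def)
    have sq: "(a - B)^2 + 16 + 8 * a = (k - 1) * (4 * (a * B))" using E C by algebra
    have "(a - B)^2 + 16 + 8 * a > 0" using pos by (simp add: add_nonneg_pos)
    moreover have "4 * (a * B) > 0" using pos BC C c by simp
    ultimately have "k - 1 > 0" using sq by (metis zero_less_mult_pos2)
    then have "1 * (4 * (a * B)) \<le> (k - 1) * (4 * (a * B))"
      using pos BC C c by (intro mult_right_mono) auto
    then have le: "4 * (a * B) \<le> (a - B)^2 + 16 + 8 * a" using sq by simp
    have "a \<le> B"
    proof (rule ccontr)
      assume "\<not> a \<le> B"
      then have "(B + 1)^2 \<le> a^2" using BC C c by (intro power_mono) auto
      then show False using H1 BC C 1 by (simp add: power2_eq_square algebra_simps)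
    qed
    then have "\<bar>a - B\<bar> \<le> 4" using H2 C by linarith
    then have "(a - B)^2 \<le> 16" using power_mono[of "\<bar>a - B\<bar>" 4 2] by simp
    moreover have "a * 9 \<le> a * B" using pos BC C 1 by (intro mult_left_mono) auto
    ultimately show False using le a 1 by linarith
  next
    case 2
    then have C: "C = 9" by (simp add: C_def)
    have le: "a * (5 * B - 18) \<le> 18 * B + 162" using main C by (simp add: algebra_simps)
    have "7 * (5 * B - 18) \<le> a * (5 * B - 18)" using a BC C 2 by (intro mult_right_mono) auto
    then have "7 * (5 * B - 18) \<le> 18 * B + 162" using le by (rule order_trans)
    then have "B \<le> 16" by simp
    then have B: "B = 16" using BC C 2 by linarith
    have "a * 62 \<le> 450" using le unfolding B by simp
    then have "a = 7" using a 2 by linarith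
    then have "736 = k * 1008" using E unfolding B C by simp
    then show False using k by linarith
  next
    case 3
    have "4 * 4 \<le> c * c" using 3 by (intro mult_mono) auto
    then have C16: "C \<ge> 16" by (simp add: C_def power2_eq_square)
    have "C * C \<le> B * C" using BC C0 c by (intro mult_right_mono) auto
    then have "a * (B * C - 4 * B - 2 * C) \<le> B * (4 * C)"
      using main by (simp add: power2_eq_square algebra_simps)
    moreover have "a * (B * (C - 6)) \<le> a * (B * C - 4 * B - 2 * C)"
      using pos BC c by (intro mult_left_mono) (auto simp: algebra_simps)
    ultimately have "B * (a * (C - 6)) \<le> B * (4 * C)" by (simp add: algebra_simps)
    then have "a * (C - 6) \<le> 4 * C" using BC C0 c by simp
    moreover have "9 * (C - 6) \<le> a * (C - 6)" using a 3 C16 by (intro mult_right_mono) auto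
    ultimately have "9 * (C - 6) \<le> 4 * C" by (rule order_trans[rotated])
    then show False using C16 by simp
  qed
qed

lemma irreducible_solution:
  assumes eq: "level_eq k a b c" and pos: "a > 0" "b > 0" "c > 0"
    and h1: "a^2 \<le> b^4 + c^4" and h2: "b^2 \<le> a + c^2" and h3: "c^2 \<le> a + b^2"
  shows "k = 7 \<and> a = 1 \<and> b = 1 \<and> c = 1"
proof -
  have ordered: "k = 7 \<and> a = 1 \<and> b = 1 \<and> c = 1"
    if "level_eq k a b c" "b > 0" "c > 0" "c \<le> b" "a^2 \<le> b^4 + c^4" "b^2 \<le> a + c^2"
    for b c
  proof (cases "c = 1")
    case True
    then show ?thesis using irreducible_min_one[of k a b] that pos by simp
  next
    case False
    then have c: "c \<ge> 2" using that by linarith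
    show ?thesis
    proof (cases "c = b")
      case True
      then show ?thesis using irreducible_diagonal[of k a b] that pos c by simp
    next
      case False
      then show ?thesis using irreducible_strict[of k a b c] that pos c by simp
    qed
  qed
  show ?thesis
  proof (cases "c \<le> b")
    case True
    then show ?thesis using ordered[of b c] assms by simp
  next
    case False
    then show ?thesis
      using ordered[of c b] assms level_eq_swap[of k a b c] by (simp add: add.commute)
  qed
qed

section \<open>Descent to the initial solution\<close>

lemma mutated_not_smaller:
  fixes x y :: int
  assumes "x * y = n" "x > 0" "\<not> y < x"
  shows "x^2 \<le> n"
  using assms by (auto simp: power2_eq_square intro: mult_left_mono)

text \<open>
  Each step of the descent exhibits the given solution as the mutation of a smaller one, because a
  mutation replaces a coordinate by a fixed quantity divided by it and so is an involution.
\<close>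
lemma level_eq_descent:
  assumes "level_eq k a b c" "a > 0" "b > 0" "c > 0"
  shows "k = 7 \<and> (of_int a, of_int b, of_int c) \<in> mutation_orbit"
  using assms
proof (induction "nat (a + b + c)" arbitrary: a b c rule: less_induct)
  case less
  obtain a' where a': "a' > 0" "a * a' = b^4 + c^4" "level_eq k a' b c"
    using level_eq_mutate_first[OF less.prems] .
  obtain b' where b': "b' > 0" "b * b' = a + c^2" "level_eq k a b' c"
    using level_eq_mutate_second[OF less.prems] .
  obtain c' where c': "c' > 0" "c * c' = a + b^2" "level_eq k a c' b"
    using level_eq_mutate_second[of k a c b] less.prems level_eq_swap[of k a b c] by blast
  consider "a' < a" | "b' < b" | "c' < c" | "\<not> a' < a" "\<not> b' < b" "\<not> c' < c" by blast
  then show ?case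
  proof cases
    case 1
    have IH: "k = 7 \<and> (of_int a', of_int b, of_int c) \<in> mutation_orbit"
      using less.hyps[of a' b c] 1 a' less.prems by simp
    have "(of_int b^4 + of_int c^4) / of_int a' = (of_int a :: rat)"
      using a' by (simp add: field_simps flip: of_int_power of_int_add of_int_mult)
    then show ?thesis using IH mutation_orbit.mu1[of "(of_int a', of_int b, of_int c)"]
      by (simp add: mu1_def)
  next
    case 2
    have IH: "k = 7 \<and> (of_int a, of_int b', of_int c) \<in> mutation_orbit"
      using less.hyps[of a b' c] 2 b' less.prems by simp
    have "(of_int a + of_int c^2) / of_int b' = (of_int b :: rat)"
      using b' by (simp add: field_simps flip: of_int_power of_int_add of_int_mult)
    then show ?thesis using IH mutation_orbit.mu2[of "(of_int a, of_int b', of_int c)"]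
      by (simp add: mu2_def)
  next
    case 3
    have IH: "k = 7 \<and> (of_int a, of_int b, of_int c') \<in> mutation_orbit"
      using less.hyps[of a b c'] 3 c' less.prems level_eq_swap[of k a c' b] by simp
    have "(of_int a + of_int b^2) / of_int c' = (of_int c :: rat)"
      using c' by (simp add: field_simps flip: of_int_power of_int_add of_int_mult)
    then show ?thesis using IH mutation_orbit.mu3[of "(of_int a, of_int b, of_int c')"]
      by (simp add: mu3_def)
  next
    case 4
    have "k = 7 \<and> a = 1 \<and> b = 1 \<and> c = 1"
      using less.prems mutated_not_smaller[OF a'(2)] mutated_not_smaller[OF b'(2)]
        mutated_not_smaller[OF c'(2)] 4
      by (intro irreducible_solution) auto
    then show ?thesis using mutation_orbit.initial by simp
  qed
qed

section \<open>Values of the polynomial\<close>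

lemma monic_rational_fiber_integral:
  fixes F :: "int poly" and x :: rat and n :: int
  assumes "degree F > 0" "lead_coeff F = 1" "poly (map_poly of_int F) x = of_int n"
  shows "x \<in> \<int>"
proof -
  have "degree (F - [:n:]) = degree F"
    unfolding diff_conv_add_uminus using assms(1) by (intro degree_add_eq_left) simp
  moreover have "coeff [:n:] (degree F) = 0" using assms(1) by (simp add: coeff_eq_0)
  ultimately have lc: "lead_coeff (F - [:n:]) = 1" using assms(2) by simp
  have "map_poly of_int (F - [:n:]) = map_poly of_int F - [:of_int n :: rat:]"
    by (rule poly_eqI) (auto simp: coeff_map_poly coeff_pCons split: nat.splits)
  then have "poly (map_poly of_int (F - [:n:])) x = 0" using assms(3) by simp
  then have "algebraic_int x" using lc algebraic_int_altdef_ipoly by blast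
  moreover have "x \<in> \<rat>" using Rats_of_rat[of x, where ?'a = rat] by simp
  ultimately show ?thesis by (rule rational_algebraic_int_is_int)
qed

lemma integral_level:
  assumes "laurent_expr x1 x2 x3 = of_int k" "x1 > 0" "x2 > 0" "x3 > 0"
  shows "level_eq k x1 x2 x3"
proof -
  have "(of_int (x1^2 + x2^4 + x3^4 + 2 * x1 * x2^2 + 2 * x1 * x3^2) :: rat) =
      of_int k * of_int (x1 * x2^2 * x3^2)"
    using assms unfolding laurent_expr_def by (subst (asm) divide_eq_eq) auto
  then have "x1^2 + x2^4 + x3^4 + 2 * x1 * x2^2 + 2 * x1 * x3^2 = k * (x1 * x2^2 * x3^2)"
    by (metis of_int_eq_iff of_int_mult)
  then show ?thesis by (simp add: level_eq_def mult.assoc)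
qed

theorem proposition1p6:
  fixes F :: "int poly" and t :: int
  assumes "degree F > 0" and "lead_coeff F = 1"
  shows "((\<exists>x1 x2 x3. pos_int_solution F t x1 x2 x3) \<longleftrightarrow> poly F t = poly F 7) \<and>
    (poly F t = poly F 7 \<longrightarrow>
      pos_int_solution F t 1 1 1 \<and>
      (\<forall>x1 x2 x3. pos_int_solution F t x1 x2 x3 \<longrightarrow>
        (of_int x1, of_int x2, of_int x3) \<in> mutation_orbit))"
proof -
  have eval: "poly (map_poly of_int F) (of_int m :: rat) = of_int (poly F m)" for m
    by (simp add: poly_altdef degree_map_poly coeff_map_poly)
  have sol: "poly F t = poly F 7 \<and> (of_int x1, of_int x2, of_int x3) \<in> mutation_orbit"
    if "pos_int_solution F t x1 x2 x3" for x1 x2 x3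
  proof -
    have pos: "x1 > 0" "x2 > 0" "x3 > 0"
      and val: "poly (map_poly of_int F) (laurent_expr x1 x2 x3) = of_int (poly F t)"
      using that by (auto simp: pos_int_solution_def)
    obtain k where k: "laurent_expr x1 x2 x3 = of_int k"
      using monic_rational_fiber_integral[OF assms val] by (elim Ints_cases)
    have "k = 7 \<and> (of_int x1, of_int x2, of_int x3) \<in> mutation_orbit"
      using level_eq_descent[OF integral_level[OF k pos] pos] .
    then show ?thesis using val eval[of k] k by simp
  qed
  have "pos_int_solution F t 1 1 1" if "poly F t = poly F 7"
    using eval[of 7] that by (simp add: pos_int_solution_def laurent_expr_def)
  then show ?thesis using sol by blast
qed

end
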